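(* Let $m$ and $n$ be positive integers, and let $x_0\in\mathbb{R}$ satisfy $\sqrt{4-(mn)^{-1}}<|x_0|\le 2$. Let $J(2m,2n)=\mathfrak{b}(4mn-1,\,4mn-2n-1)$ and $J(2m,-2n)=\mathfrak{b}(4mn+1,\,4mn-2n+1)$, with Riley polynomials $\Phi_{J(2m,2n)}(x,y)$ and $\Phi_{J(2m,-2n)}(x,y)$. Then (i) the equation $\Phi_{J(2m,2n)}(x_0,y)=0$ has exactly one real solution $y$, and (ii) the equation $\Phi_{J(2m,-2n)}(x_0,y)=0$ has no real solutions $y$.
   Context: Two-bridge knots: for relatively prime odd integers $p>q\ge 1$, $\mathfrak{b}(p,q)$ is the two-bridge knot whose double branched cover is the lens space $L(p,q)$. Its knot group has the Schubert presentation $\langle a,b\mid wa=bw\rangle$, where $a,b$ are meridians, $w=a^{\varepsilon_1}b^{\varepsilon_2}\cdots a^{\varepsilon_{p-2}}b^{\varepsilon_{p-1}}$ (letters alternate $a,b$) and $\varepsilon_j=(-1)^{\lfloor jq/p\rfloor}$. The double twist knots $J(2m,2n)$ and $J(2m,-2n)$ are the two-bridge knots $\mathfrak{b}(p,q)$ with the values of $p,q$ given in the claim. Riley polynomial: for $s\in\mathbb{C}\setminus\{0\}$ and $y\in\mathbb{C}$ put $$A=\begin{pmatrix} s & 1 \\ 0 & s^{-1} \end{pmatrix},\qquad B=\begin{pmatrix} s & 0 \\ 2-y & s^{-1} \end{pmatrix},$$ and let $W=(W_{ij})$ be the matrix obtained from the word $w$ by substituting $a\mapsto A$, $b\mapsto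 B$. The matrix equation $WA=BW$ is equivalent to the single equation $\widetilde\Phi_{\mathfrak{b}(p,q)}(s,y)=0$, where $\widetilde\Phi_{\mathfrak{b}(p,q)}(s,y)=W_{11}+(s^{-1}-s)W_{12}$ (in fact $WA-BW=\widetilde\Phi_{\mathfrak{b}(p,q)}(s,y)\begin{pmatrix} 0 & 1 \\ {y-2} & 0 \end{pmatrix}$). One has $\widetilde\Phi_{\mathfrak{b}(p,q)}(s,y)=\widetilde\Phi_{\mathfrak{b}(p,q)}(s^{-1},y)$, so it can be written as a polynomial in $x=s+s^{-1}$ and $y$; this polynomial is the Riley polynomial $\Phi_{\mathfrak{b}(p,q)}(x,y)$. *)

theory Defs
  imports "HOL-Analysis.Analysis" "HOL-Computational_Algebra.Polynomial"
begin

section \<open>Schubert words\<close>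

datatype meridian = Mer_a | Mer_b

definition schubert_eps :: "nat \<Rightarrow> nat \<Rightarrow> nat \<Rightarrow> int" where
  "schubert_eps p q j = (-1) ^ (j * q div p)"

text \<open>A word in the free group on \<open>a\<close>, \<open>b\<close> is a list of letters with exponent \<open>\<plusminus>1\<close>.\<close>

definition schubert_word :: "nat \<Rightarrow> nat \<Rightarrow> (meridian \<times> int) list" where
  "schubert_word p q =
     map (\<lambda>j. (if odd j then Mer_a else Mer_b, schubert_eps p q j)) [1..<p]"

definition subst_letter ::
    "complex^2^2 \<Rightarrow> complex^2^2 \<Rightarrow> meridian \<times> int \<Rightarrow> complex^2^2" where
  "subst_letter A B l =
     (let M = (case fst l of Mer_a \<Rightarrow> A | Mer_b \<Rightarrow> B)
      in if snd l = 1 then M else matrix_inv M)"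

definition subst_word ::
    "complex^2^2 \<Rightarrow> complex^2^2 \<Rightarrow> (meridian \<times> int) list \<Rightarrow> complex^2^2" where
  "subst_word A B w = foldr (\<lambda>l M. subst_letter A B l ** M) w (mat 1)"


section \<open>The Riley polynomial\<close>

definition riley_A :: "complex \<Rightarrow> complex^2^2" where
  "riley_A s = vector [vector [s, 1], vector [0, inverse s]]"

definition riley_B :: "complex \<Rightarrow> complex \<Rightarrow> complex^2^2" where
  "riley_B s y = vector [vector [s, 0], vector [2 - y, inverse s]]"

definition riley_W :: "nat \<Rightarrow> nat \<Rightarrow> complex \<Rightarrow> complex \<Rightarrow> complex^2^2" where
  "riley_W p q s y = subst_word (riley_A s) (riley_B s y) (schubert_word p q)"

definition riley_tilde :: "nat \<Rightarrow> nat \<Rightarrow> complex \<Rightarrow> complex \<Rightarrow> complex" where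
  "riley_tilde p q s y =
     riley_W p q s y $ 1 $ 1 + (inverse s - s) * riley_W p q s y $ 1 $ 2"

text \<open>A polynomial in \<open>x\<close> and \<open>y\<close> is a polynomial in \<open>y\<close> whose coefficients are
  polynomials in \<open>x\<close>.\<close>

definition eval2 :: "complex poly poly \<Rightarrow> complex \<Rightarrow> complex \<Rightarrow> complex" where
  "eval2 P x y = poly (poly P [:y:]) x"

text \<open>Existence and uniqueness, for coprime odd \<open>p\<close>, \<open>q\<close>, are proved in
  \<open>riley_poly_unique_existence\<close> below.\<close>

definition riley_poly :: "nat \<Rightarrow> nat \<Rightarrow> complex poly poly" where
  "riley_poly p q =
     (THE P. \<forall>s y. s \<noteq> 0 \<longrightarrow> eval2 P (s + inverse s) y = riley_tilde p q s y)"


section \<open>Well-definedness of the Riley polynomial\<close>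

lemma eval2_simps [simp]:
  "eval2 (P + Q) x y = eval2 P x y + eval2 Q x y"
  "eval2 (P - Q) x y = eval2 P x y - eval2 Q x y"
  "eval2 (- P) x y = - eval2 P x y"
  "eval2 (P * Q) x y = eval2 P x y * eval2 Q x y"
  "eval2 0 x y = 0"
  "eval2 1 x y = 1"
  "eval2 [:[:0, 1:]:] x y = x"
  "eval2 [:0, 1:] x y = y"
  by (simp_all add: eval2_def)

lemma eval2_numeral [simp]: "eval2 (numeral k) x y = numeral k"
  by (simp add: eval2_def)

lemma joukowski_surj: "\<exists>s::complex. s \<noteq> 0 \<and> s + inverse s = x"
proof -
  define r where "r = csqrt (x^2 - 4)"
  define s where "s = (x + r) / 2"
  have r2: "r^2 = x^2 - 4" by (simp add: r_def)
  have prod: "s * ((x - r) / 2) = 1"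
    using r2 by (simp add: s_def field_simps power2_eq_square)
  then have "s \<noteq> 0" by auto
  moreover have "inverse s = (x - r) / 2" by (rule inverse_unique[OF prod])
  moreover have "s + (x - r) / 2 = x" by (simp add: s_def field_simps)
  ultimately show ?thesis by metis
qed

lemma eval2_eq_0_imp:
  assumes "\<And>x y. eval2 P x y = 0"
  shows "P = 0"
proof (rule ccontr)
  assume "P \<noteq> 0"
  have "poly P [:y:] = 0" for y
    using assms[of _ y] by (intro poly_all_0_iff_0[THEN iffD1]) (simp add: eval2_def)
  then have "range (\<lambda>y::complex. [:y:]) \<subseteq> {z. poly P z = 0}" by auto
  then have "finite (range (\<lambda>y::complex. [:y:]))"
    using poly_roots_finite[OF \<open>P \<noteq> 0\<close>] finite_subset by blast
  moreover have "inj (\<lambda>y::complex. [:y:])" by (auto simp: inj_def)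
  ultimately show False
    using finite_imageD infinite_UNIV_char_0 by blast
qed

lemma eval2_eqI:
  assumes "\<And>s y. s \<noteq> 0 \<Longrightarrow> eval2 P (s + inverse s) y = eval2 Q (s + inverse s) y"
  shows "P = Q"
proof -
  have "eval2 (P - Q) x y = 0" for x y
    using joukowski_surj[of x] assms by auto
  then have "P - Q = 0" by (rule eval2_eq_0_imp)
  then show ?thesis by simp
qed

definition mat22 :: "complex \<Rightarrow> complex \<Rightarrow> complex \<Rightarrow> complex \<Rightarrow> complex^2^2" where
  "mat22 a b c d = vector [vector [a, b], vector [c, d]]"

lemma mat22_nth [simp]:
  "mat22 a b c d $ 1 $ 1 = a" "mat22 a b c d $ 1 $ 2 = b"
  "mat22 a b c d $ 2 $ 1 = c" "mat22 a b c d $ 2 $ 2 = d"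
  by (simp_all add: mat22_def)

lemma mat22_eq_iff [simp]:
  "mat22 a b c d = mat22 a' b' c' d' \<longleftrightarrow> a = a' \<and> b = b' \<and> c = c' \<and> d = d'"
  by (metis mat22_nth)

lemma mat22_mult [simp]:
  "mat22 a b c d ** mat22 a' b' c' d' =
     mat22 (a * a' + b * c') (a * b' + b * d') (c * a' + d * c') (c * b' + d * d')"
  by (simp add: vec_eq_iff forall_2 matrix_matrix_mult_def sum_2)

lemma mat_1_mat22: "mat 1 = mat22 1 0 0 1"
  by (simp add: vec_eq_iff forall_2 mat_def)

lemma matrix_inv_mat22:
  assumes "a * d - b * c = 1"
  shows "matrix_inv (mat22 a b c d) = mat22 d (- b) (- c) a"
proof -
  let ?M = "mat22 a b c d" and ?N = "mat22 d (- b) (- c) a"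
  have 1: "?M ** ?N = mat 1" "?N ** ?M = mat 1"
    using assms by (auto simp: mat_1_mat22 algebra_simps)
  then have "?M ** matrix_inv ?M = mat 1"
    unfolding matrix_inv_def by (metis (mono_tags, lifting) someI_ex)
  then have "?N ** (?M ** matrix_inv ?M) = ?N" by simp
  then show ?thesis using 1 by (simp add: matrix_mul_assoc)
qed

text \<open>The exponents satisfy \<open>\<epsilon>\<^sub>p\<^sub>-\<^sub>j = \<epsilon>\<^sub>j\<close>, so \<open>w\<close> is built from the middle outwards by
  \<open>v \<mapsto> a\<^sup>\<epsilon> v b\<^sup>\<epsilon>\<close> and \<open>v \<mapsto> b\<^sup>\<epsilon> v a\<^sup>\<epsilon>\<close>.  These operations preserve the matrices
  \<open>\<alpha> + \<beta> (A + B) + \<delta> A B\<close> whose coefficients are polynomials in \<open>x\<close> and \<open>y\<close>.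
  Below, \<open>r\<close> stands for \<open>inverse s\<close>.\<close>

definition sym_mat ::
    "complex \<Rightarrow> complex \<Rightarrow> complex \<Rightarrow> complex \<Rightarrow> complex \<Rightarrow> complex \<Rightarrow> complex^2^2" where
  "sym_mat s r y \<alpha> \<beta> \<delta> =
     mat22 (\<alpha> + 2 * s * \<beta> + (s^2 + 2 - y) * \<delta>) (\<beta> + r * \<delta>)
           ((2 - y) * \<beta> + (2 - y) * r * \<delta>) (\<alpha> + 2 * r * \<beta> + r^2 * \<delta>)"

lemma sandwich:
  fixes s r y \<alpha> \<beta> \<delta> :: complex
  defines "x \<equiv> s + r"
  defines "A \<equiv> mat22 s 1 0 r" and "B \<equiv> mat22 s 0 (2 - y) r"
    and "A' \<equiv> mat22 r (-1) 0 s" and "B' \<equiv> mat22 r 0 (y - 2) s"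
  assumes sr: "s * r = 1"
  shows "A ** sym_mat s r y \<alpha> \<beta> \<delta> ** B =
           sym_mat s r y \<delta> (- \<beta> - x * \<delta>) (\<alpha> + 2 * x * \<beta> + x^2 * \<delta>)"
    and "B ** sym_mat s r y \<alpha> \<beta> \<delta> ** A =
           sym_mat s r y (- y * \<alpha> - 2 * x * y * \<beta> - ((x^2 - y) * y + 1) * \<delta>)
             (x * \<alpha> + (2 * x^2 - 1) * \<beta> + (x^2 - y) * x * \<delta>)
             (- \<alpha> - 2 * x * \<beta> - (x^2 - y) * \<delta>)"
    and "A' ** sym_mat s r y \<alpha> \<beta> \<delta> ** B' =
           sym_mat s r y (x^2 * \<alpha> + 2 * x * \<beta> + \<delta>) (- x * \<alpha> - \<beta>) \<alpha>"
    and "B' ** sym_mat s r y \<alpha> \<beta> \<delta> ** A' =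
           sym_mat s r y
             ((x^2 - y) * \<alpha> + 2 * x * \<beta> + (2 * x^2 - (x^2 - y) * y - 1) * \<delta>)
             (- \<beta> - x * \<delta>) (- \<alpha> + y * \<delta>)"
  unfolding x_def A_def B_def A'_def B'_def sym_mat_def mat22_mult mat22_eq_iff
  by (intro conjI; use sr in algebra)+

text \<open>Substituted letters and subwords, as families of matrices indexed by \<open>s\<close> and \<open>y\<close>.\<close>

definition letter_mat :: "nat \<Rightarrow> nat \<Rightarrow> nat \<Rightarrow> complex \<Rightarrow> complex \<Rightarrow> complex^2^2" where
  "letter_mat p q j s y = subst_letter (riley_A s) (riley_B s y)
     (if odd j then Mer_a else Mer_b, schubert_eps p q j)"

definition block_mat :: "nat \<Rightarrow> nat \<Rightarrow> nat list \<Rightarrow> complex \<Rightarrow> complex \<Rightarrow> complex^2^2" where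
  "block_mat p q js s y = foldr (\<lambda>j M. letter_mat p q j s y ** M) js (mat 1)"

lemma riley_W_block: "riley_W p q s y = block_mat p q [1..<p] s y"
  by (simp add: riley_W_def subst_word_def schubert_word_def block_mat_def letter_mat_def
      foldr_map o_def)

lemma block_mat_append:
  "block_mat p q (js @ ks) s y = block_mat p q js s y ** block_mat p q ks s y"
  by (induction js) (simp_all add: block_mat_def matrix_mul_assoc)

lemma schubert_eps_sym:
  assumes "odd q" "coprime p q" "0 < j" "j < p"
  shows "schubert_eps p q (p - j) = schubert_eps p q j"
proof -
  define f where "f = j * q div p"
  define r where "r = j * q mod p"
  have jq: "j * q = f * p + r" by (simp add: f_def r_def)
  have "\<not> p dvd j * q"
    using assms by (metis coprime_dvd_mult_left_iff nat_dvd_not_less)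
  then have r: "0 < r" "r < p" using assms by (auto simp: r_def dvd_eq_mod_eq_0)
  have "(p - j) * q + j * q = q * p"
    using assms by (simp flip: add_mult_distrib)
  then have e: "(p - j) * q + r + f * p = q * p" using jq by simp
  have "f < q"
  proof (rule ccontr)
    assume "\<not> f < q"
    then have "q * p \<le> f * p" by simp
    with e r show False by linarith
  qed
  then obtain k where k: "q = f + Suc k" by (metis less_iff_Suc_add add_Suc_right)
  then have "(p - j) * q + r = Suc k * p" using e by (simp add: algebra_simps)
  then have "(p - j) * q = k * p + (p - r)" using r by simp
  moreover have "(k * p + (p - r)) div p = k"
    using r by (intro div_nat_eqI) (auto simp: algebra_simps)
  ultimately have "(p - j) * q div p = k" by simp
  moreover have "even k \<longleftrightarrow> even f" using k assms(1) by auto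
  ultimately show ?thesis
    by (simp add: schubert_eps_def f_def[symmetric] minus_one_power_iff)
qed

lemma letter_mat_cases:
  assumes "s \<noteq> 0"
  shows "letter_mat p q j s y =
    (if schubert_eps p q j = 1
     then (if odd j then mat22 s 1 0 (inverse s) else mat22 s 0 (2 - y) (inverse s))
     else (if odd j then mat22 (inverse s) (-1) 0 s else mat22 (inverse s) 0 (y - 2) s))"
  using assms
  by (simp add: letter_mat_def subst_letter_def riley_A_def riley_B_def Let_def
      mat22_def[symmetric] matrix_inv_mat22)

lemma block_mat_sym:
  assumes p: "p = 2 * h + 1" and q: "odd q" "coprime p q" and "i \<le> h"
  shows "\<exists>P Q R. \<forall>s y. s \<noteq> 0 \<longrightarrow> block_mat p q [h - i + 1..<h + i + 1] s y =
    sym_mat s (inverse s) y (eval2 P (s + inverse s) y) (eval2 Q (s + inverse s) y)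
      (eval2 R (s + inverse s) y)"
  using \<open>i \<le> h\<close>
proof (induction i)
  case 0
  show ?case
    by (intro exI[of _ 1] exI[of _ 0]) (simp add: block_mat_def sym_mat_def mat_1_mat22)
next
  case (Suc i)
  from Suc obtain P Q R where IH: "s \<noteq> 0 \<Longrightarrow> block_mat p q [h - i + 1..<h + i + 1] s y =
      sym_mat s (inverse s) y (eval2 P (s + inverse s) y) (eval2 Q (s + inverse s) y)
        (eval2 R (s + inverse s) y)" for s y
    by (metis Suc_leD)
  have "[h - Suc i + 1..<h + Suc i + 1] = (h - i) # [h - i + 1..<h + i + 1] @ [h + i + 1]"
  proof -
    have "[h - Suc i + 1..<h + Suc i + 1] = [h - i..<Suc (h + i + 1)]"
      using Suc.prems by (simp add: Suc_diff_Suc del: upt_Suc)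
    also have "\<dots> = [h - i..<h + i + 1] @ [h + i + 1]" by simp
    also have "[h - i..<h + i + 1] = (h - i) # [h - i + 1..<h + i + 1]"
      using upt_conv_Cons[of "h - i" "h + i + 1"] by simp
    finally show ?thesis by simp
  qed
  then have split: "block_mat p q [h - Suc i + 1..<h + Suc i + 1] s y =
      letter_mat p q (h - i) s y ** block_mat p q [h - i + 1..<h + i + 1] s y
        ** letter_mat p q (h + i + 1) s y" for s y
  proof -
    have "block_mat p q (j # js @ [k]) s y =
        letter_mat p q j s y ** block_mat p q js s y ** letter_mat p q k s y" for j js k
      using block_mat_append[of p q "[j]" "js @ [k]" s y] block_mat_append[of p q js "[k]" s y]
      by (simp add: block_mat_def matrix_mul_assoc)
    then show ?thesis
      by (subst \<open>[h - Suc i + 1..<h + Suc i + 1] = _\<close>)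
  qed
  have "p - (h - i) = h + i + 1" using p Suc.prems by simp
  then have eps: "schubert_eps p q (h + i + 1) = schubert_eps p q (h - i)"
    using schubert_eps_sym[OF q, of "h - i"] p Suc.prems by simp
  have par: "odd (h + i + 1) \<longleftrightarrow> even (h - i)"
    using Suc.prems by auto
  define S where "S s y = sym_mat s (inverse s) y (eval2 P (s + inverse s) y)
    (eval2 Q (s + inverse s) y) (eval2 R (s + inverse s) y)" for s y
  have key: "block_mat p q [h - Suc i + 1..<h + Suc i + 1] s y =
    (if schubert_eps p q (h - i) = 1 then
       (if odd (h - i)
        then mat22 s 1 0 (inverse s) ** S s y ** mat22 s 0 (2 - y) (inverse s)
        else mat22 s 0 (2 - y) (inverse s) ** S s y ** mat22 s 1 0 (inverse s))
     else
       (if odd (h - i)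
        then mat22 (inverse s) (-1) 0 s ** S s y ** mat22 (inverse s) 0 (y - 2) s
        else mat22 (inverse s) 0 (y - 2) s ** S s y ** mat22 (inverse s) (-1) 0 s))"
    if "s \<noteq> 0" for s y
    unfolding split IH[OF that] S_def[symmetric] letter_mat_cases[OF that] eps par
    by simp
  obtain X Y where XY [simp]: "eval2 X x y = x" "eval2 Y x y = y" for x y
    using eval2_simps(7,8) by metis
  have sq: "t^2 = t * t" for t :: complex by (rule power2_eq_square)
  show ?case
  proof (cases "schubert_eps p q (h - i) = 1"; cases "odd (h - i)")
    assume "schubert_eps p q (h - i) = 1" "odd (h - i)"
    with key have "s \<noteq> 0 \<Longrightarrow> block_mat p q [h - Suc i + 1..<h + Suc i + 1] s y =
        sym_mat s (inverse s) y
          (eval2 R (s + inverse s) y)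
          (eval2 (- Q - X * R) (s + inverse s) y)
          (eval2 (P + 2 * X * Q + X * X * R) (s + inverse s) y)"
      for s y by (simp add: S_def sandwich sq del: upt_Suc even_diff_nat)
    then show ?thesis by blast
  next
    assume "schubert_eps p q (h - i) = 1" "\<not> odd (h - i)"
    with key have "s \<noteq> 0 \<Longrightarrow> block_mat p q [h - Suc i + 1..<h + Suc i + 1] s y =
        sym_mat s (inverse s) y
          (eval2 (- Y * P - 2 * X * Y * Q - ((X * X - Y) * Y + 1) * R) (s + inverse s) y)
          (eval2 (X * P + (2 * (X * X) - 1) * Q + (X * X - Y) * X * R) (s + inverse s) y)
          (eval2 (- P - 2 * X * Q - (X * X - Y) * R) (s + inverse s) y)"
      for s y by (simp add: S_def sandwich sq del: upt_Suc even_diff_nat)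
    then show ?thesis by blast
  next
    assume "schubert_eps p q (h - i) \<noteq> 1" "odd (h - i)"
    with key have "s \<noteq> 0 \<Longrightarrow> block_mat p q [h - Suc i + 1..<h + Suc i + 1] s y =
        sym_mat s (inverse s) y
          (eval2 (X * X * P + 2 * X * Q + R) (s + inverse s) y)
          (eval2 (- X * P - Q) (s + inverse s) y)
          (eval2 P (s + inverse s) y)"
      for s y by (simp add: S_def sandwich sq algebra_simps del: upt_Suc even_diff_nat)
    then show ?thesis by blast
  next
    assume "schubert_eps p q (h - i) \<noteq> 1" "\<not> odd (h - i)"
    with key have "s \<noteq> 0 \<Longrightarrow> block_mat p q [h - Suc i + 1..<h + Suc i + 1] s y =
        sym_mat s (inverse s) y
          (eval2 ((X * X - Y) * P + 2 * X * Q
              + (2 * (X * X) - (X * X - Y) * Y - 1) * R) (s + inverse s) y)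
          (eval2 (- Q - X * R) (s + inverse s) y)
          (eval2 (- P + Y * R) (s + inverse s) y)"
      for s y by (simp add: S_def sandwich sq del: upt_Suc even_diff_nat)
    then show ?thesis by blast
  qed
qed

theorem riley_poly_unique_existence:
  assumes "odd p" "odd q" "coprime p q"
  shows "\<exists>!P. \<forall>s y. s \<noteq> 0 \<longrightarrow> eval2 P (s + inverse s) y = riley_tilde p q s y"
proof -
  from assms(1) obtain h where p: "p = 2 * h + 1" by (rule oddE)
  have range: "[h - h + 1..<h + h + 1] = [1..<p]" using p by (simp add: mult_2 del: upt_Suc)
  obtain P Q R where W: "s \<noteq> 0 \<Longrightarrow> riley_W p q s y =
      sym_mat s (inverse s) y (eval2 P (s + inverse s) y) (eval2 Q (s + inverse s) y)
        (eval2 R (s + inverse s) y)" for s y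
    using block_mat_sym[OF p assms(2,3) order.refl, unfolded range]
    unfolding riley_W_block by metis
  obtain X Y where XY [simp]: "eval2 X x y = x" "eval2 Y x y = y" for x y
    using eval2_simps(7,8) by metis
  have "eval2 (P + X * Q + (X * X - 1 - Y) * R) (s + inverse s) y = riley_tilde p q s y"
    if "s \<noteq> 0" for s y
    using that by (simp add: riley_tilde_def W sym_mat_def field_simps power2_eq_square)
  then show ?thesis
    by (intro ex_ex1I) (blast, intro eval2_eqI, simp)
qed

lemma eval2_riley_poly:
  assumes "odd p" "odd q" "coprime p q" "s \<noteq> 0"
  shows "eval2 (riley_poly p q) (s + inverse s) y = riley_tilde p q s y"
  using theI'[OF riley_poly_unique_existence[OF assms(1-3)]] assms(4)
  unfolding riley_poly_def by blast

end

theory Submission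
  imports Defs
begin

text \<open>
  Put \<open>u = y - 2\<close>, \<open>c = 4 - x\<^sup>2\<close>, let \<open>a\<close>, \<open>b\<close> be the Chebyshev values \<open>S\<^sub>m\<^sub>-\<^sub>1(y)\<close>, \<open>S\<^sub>m\<^sub>-\<^sub>2(y)\<close>, and
  let \<open>A\<close>, \<open>B\<close> be the values of \<open>S\<^sub>n\<^sub>-\<^sub>1\<close> and of \<open>S\<^sub>n\<^sub>-\<^sub>2\<close> (for \<open>J(2m,2n)\<close>) or \<open>S\<^sub>n\<close> (for \<open>J(2m,-2n)\<close>)
  at \<open>z = 2 + v\<close>, where \<open>v = u (u + c) a\<^sup>2\<close>.  The Schubert words are, for
  \<open>J(2m,2n)\<close> up to an outer \<open>b\<close> and \<open>a\<close>, the \<open>n\<close>-th powers of words \<open>(ab\<^sup>-\<^sup>1)\<^sup>m (a\<^sup>-\<^sup>1b)\<^sup>m\<close> or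
  \<open>(b\<^sup>-\<^sup>1a)\<^sup>m (ba\<^sup>-\<^sup>1)\<^sup>m\<close>, so Cayley-Hamilton turns both Riley equations into
  \<open>A - B = (u + c) a (a - b) A\<close>.  With \<open>g = (a - b) / (a u)\<close> and \<open>\<rho> = 4 g (1 + g)\<close> a zero satisfies
  \<open>u (\<rho> u - 4) / 4 = 1 / a\<^sup>2\<close>, \<open>v (\<rho> v - 4) / 4 = 1 / A\<^sup>2\<close> and \<open>c = \<rho> u v / 4 - u - v\<close>,
  which is symmetric in the two factors.

  If \<open>u < 0 < v\<close>, this gives \<open>c < 0\<close>.  If \<open>u, v < 0\<close>, then \<open>\<bar>a\<bar> \<le> m\<close> and \<open>\<bar>A\<bar> \<le> n\<close>, and the
  identities give \<open>c\<^sup>2 > 1 / (a A)\<^sup>2 \<ge> 1 / (m n)\<^sup>2\<close>.  Both contradict \<open>0 \<le> c < 1 / (m n)\<close>.  If \<open>u > 0\<close>, the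
  Riley polynomial of \<open>J(2m,-2n)\<close> is positive, while along the zeros of the one of \<open>J(2m,2n)\<close> the
  quantity \<open>\<rho>\<close> strictly decreases in \<open>u\<close> and \<open>c\<close> strictly increases in \<open>\<rho>\<close>, so that at most one zero belongs
  to a given \<open>c\<close>; it exists in \<open>[2, 3]\<close> by the intermediate value theorem.
\<close>


section \<open>Chebyshev polynomials and powers of matrices\<close>

text \<open>The index is shifted: \<open>chebS k\<close> is the Chebyshev polynomial usually called \<open>S\<^sub>k\<^sub>-\<^sub>1\<close>.\<close>

fun chebS :: "nat \<Rightarrow> 'a::comm_ring_1 \<Rightarrow> 'a" where
  "chebS 0 y = 0"
| "chebS (Suc 0) y = 1"
| "chebS (Suc (Suc k)) y = y * chebS (Suc k) y - chebS k y"

text \<open>The quadratic form \<open>X^2 - y X Y + Y^2\<close> is invariant under the recursion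
  step and equals 1 at the start.\<close>

lemma chebS_norm:
  "chebS (Suc k) y ^ 2 - y * chebS (Suc k) y * chebS k y + chebS k y ^ 2 = 1"
  by (induction k) (auto simp: algebra_simps power2_eq_square)

lemma chebS_of_real: "chebS k (of_real y :: 'a::{real_algebra_1,comm_ring_1}) = of_real (chebS k y)"
  by (induction k y rule: chebS.induct) simp_all

lemma chebS_two: "chebS k (2 :: real) = real k"
  by (induction k "2::real" rule: chebS.induct) simp_all

abbreviation mat_pow :: "complex^2^2 \<Rightarrow> nat \<Rightarrow> complex^2^2" where
  "mat_pow M k \<equiv> ((**) M ^^ k) (mat 1)"

text \<open>By Cayley-Hamilton a matrix \<open>X\<close> of determinant 1 and trace \<open>y\<close>
  satisfies \<open>X^2 = y X - 1\<close>, so its powers are combinations of \<open>X\<close> and the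
  identity whose coefficients obey the Chebyshev recursion.\<close>

lemma mat_pow_chebS:
  assumes det: "a * d - b * c = 1" and tr: "a + d = y"
  shows "mat_pow (mat22 a b c d) (Suc k) =
    mat22 (chebS (Suc k) y * a - chebS k y) (chebS (Suc k) y * b)
          (chebS (Suc k) y * c) (chebS (Suc k) y * d - chebS k y)"
proof (induction k)
  case 0
  show ?case by (simp add: mat_1_mat22)
next
  case (Suc k)
  have "mat_pow (mat22 a b c d) (Suc (Suc k)) = mat22 a b c d ** mat_pow (mat22 a b c d) (Suc k)"
    by simp
  also have "\<dots> = mat22 (chebS (Suc (Suc k)) y * a - chebS (Suc k) y) (chebS (Suc (Suc k)) y * b)
          (chebS (Suc (Suc k)) y * c) (chebS (Suc (Suc k)) y * d - chebS (Suc k) y)"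
    unfolding Suc.IH mat22_mult mat22_eq_iff chebS.simps using det tr
    by (intro conjI; algebra)
  finally show ?case .
qed

section \<open>The Riley functional on powers of block words\<close>

definition riley_functional :: "complex^2^2 \<Rightarrow> complex \<Rightarrow> complex \<Rightarrow> complex" where
  "riley_functional M s r = M $ 1 $ 1 + (r - s) * M $ 1 $ 2"

lemma riley_functional_mat22: "riley_functional (mat22 a b c d) s r = a + (r - s) * b"
  by (simp add: riley_functional_def)

text \<open>The functional is linear and equals 1 on the identity, so after
  \<open>mat_pow_chebS\<close> only its value on a single block and the trace \<open>z\<close> of
  that block are needed.\<close>

lemma riley_functional_minus:
  fixes s r y :: complex and M N :: nat
  assumes sr: "s * r = 1"
  defines "A \<equiv> mat22 s 1 0 r" and "B \<equiv> mat22 s 0 (2 - y) r"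
    and "A' \<equiv> mat22 r (-1) 0 s" and "B' \<equiv> mat22 r 0 (y - 2) s"
  defines "a \<equiv> chebS (Suc M) y" and "b \<equiv> chebS M y" and "t \<equiv> y + 2 - (s + r)^2"
  defines "z \<equiv> 2 + (y - 2) * t * a ^ 2"
  shows "riley_functional (mat_pow (mat_pow (A ** B') (Suc M) ** mat_pow (A' ** B) (Suc M)) (Suc N)) s r
    = chebS (Suc (Suc N)) z - chebS (Suc N) z + t * a * (a - b) * chebS (Suc N) z"
proof -
  have nrm: "a ^ 2 - y * a * b + b ^ 2 = 1" unfolding a_def b_def by (rule chebS_norm)
  have srw: "r * (s * w) = w" for w using sr by algebra
  have AB: "A ** B' = mat22 (y - 1) s (r * (y - 2)) 1"
    unfolding A_def B'_def mat22_mult mat22_eq_iff using sr by (auto simp: algebra_simps)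
  have BA: "A' ** B = mat22 (y - 1) (- r) (s * (2 - y)) 1"
    unfolding A'_def B_def mat22_mult mat22_eq_iff using sr by (auto simp: algebra_simps)
  have 1: "mat_pow (A ** B') (Suc M) = mat22 (a * (y - 1) - b) (a * s) (a * (r * (y - 2))) (a - b)"
    unfolding AB a_def b_def
    by (subst mat_pow_chebS[where y = y]) (use sr in \<open>auto simp: algebra_simps srw\<close>)
  have 2: "mat_pow (A' ** B) (Suc M) = mat22 (a * (y - 1) - b) (- a * r) (a * (s * (2 - y))) (a - b)"
    unfolding BA a_def b_def
    by (subst mat_pow_chebS[where y = y]) (use sr in \<open>auto simp: algebra_simps srw\<close>)
  define p q p' q' where "p = (a * (y - 1) - b)^2 + a^2 * s^2 * (2 - y)"
    and "q = - a * r * (a * (y - 1) - b) + a * s * (a - b)"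
    and "p' = a * (r * (y - 2)) * (a * (y - 1) - b) + (a - b) * a * (s * (2 - y))"
    and "q' = (a - b)^2 + a^2 * r^2 * (2 - y)"
  have 3: "mat_pow (A ** B') (Suc M) ** mat_pow (A' ** B) (Suc M) = mat22 p q p' q'"
    unfolding 1 2 mat22_mult mat22_eq_iff p_def q_def p'_def q'_def
    by (intro conjI; algebra)
  have tr: "p + q' = z"
    unfolding p_def q'_def z_def t_def using sr nrm by algebra
  \<comment> \<open>The determinants of the two factors; multiplied, they give
    \<open>det\<close>.\<close>
  have d1: "(a * (y - 1) - b) * (a - b) - (a * s) * (a * (r * (y - 2))) = 1"
    and d2: "(a * (y - 1) - b) * (a - b) - (- a * r) * (a * (s * (2 - y))) = 1"
    using sr nrm by algebra+
  have det: "p * q' - q * p' = 1"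
    unfolding p_def q_def p'_def q'_def using d1 d2 by algebra
  have "p + (r - s) * q = z - (1 - t * a * (a - b))"
    unfolding p_def q_def z_def t_def using sr nrm by algebra
  then show ?thesis
    unfolding 3 mat_pow_chebS[OF det tr] riley_functional_mat22 chebS.simps by algebra
qed

text \<open>The functional also equals 1 on \<open>B ** A\<close>, so the outer letters do no harm;
  its value on \<open>B\<close>, one block and \<open>A\<close> is the identity \<open>U\<close> of
  the proof.\<close>

lemma riley_functional_plus:
  fixes s r y :: complex and M N :: nat
  assumes sr: "s * r = 1"
  defines "A \<equiv> mat22 s 1 0 r" and "B \<equiv> mat22 s 0 (2 - y) r"
    and "A' \<equiv> mat22 r (-1) 0 s" and "B' \<equiv> mat22 r 0 (y - 2) s"
  defines "a \<equiv> chebS (Suc M) y" and "b \<equiv> chebS M y" and "t \<equiv> y + 2 - (s + r)^2"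
  defines "z \<equiv> 2 + (y - 2) * t * a ^ 2"
  shows "riley_functional
      (B ** mat_pow (mat_pow (B' ** A) (Suc M) ** mat_pow (B ** A') (Suc M)) (Suc N) ** A) s r
    = chebS (Suc N) z - chebS N z - t * a * (a - b) * chebS (Suc N) z"
proof -
  have nrm: "a ^ 2 - y * a * b + b ^ 2 = 1" unfolding a_def b_def by (rule chebS_norm)
  have srw: "r * (s * w) = w" for w using sr by algebra
  have AB: "B' ** A = mat22 1 r (s * (y - 2)) (y - 1)"
    unfolding A_def B'_def mat22_mult mat22_eq_iff using sr by (auto simp: algebra_simps)
  have BA: "B ** A' = mat22 1 (- s) (r * (2 - y)) (y - 1)"
    unfolding A'_def B_def mat22_mult mat22_eq_iff using sr by (auto simp: algebra_simps)
  have 1: "mat_pow (B' ** A) (Suc M) = mat22 (a - b) (a * r) (a * (s * (y - 2))) (a * (y - 1) - b)"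
    unfolding AB a_def b_def
    by (subst mat_pow_chebS[where y = y]) (use sr in \<open>auto simp: algebra_simps srw\<close>)
  have 2: "mat_pow (B ** A') (Suc M) = mat22 (a - b) (- a * s) (a * (r * (2 - y))) (a * (y - 1) - b)"
    unfolding BA a_def b_def
    by (subst mat_pow_chebS[where y = y]) (use sr in \<open>auto simp: algebra_simps srw\<close>)
  define p q p' q' where "p = (a - b)^2 + a^2 * r^2 * (2 - y)"
    and "q = - a * s * (a - b) + a * r * (a * (y - 1) - b)"
    and "p' = a * (s * (y - 2)) * (a - b) + (a * (y - 1) - b) * a * (r * (2 - y))"
    and "q' = (a * (y - 1) - b)^2 + a^2 * s^2 * (2 - y)"
  have 3: "mat_pow (B' ** A) (Suc M) ** mat_pow (B ** A') (Suc M) = mat22 p q p' q'"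
    unfolding 1 2 mat22_mult mat22_eq_iff p_def q_def p'_def q'_def
    by (intro conjI; algebra)
  have tr: "p + q' = z"
    unfolding p_def q'_def z_def t_def using sr nrm by algebra
  have d1: "(a * (y - 1) - b) * (a - b) - (a * r) * (a * (s * (y - 2))) = 1"
    and d2: "(a * (y - 1) - b) * (a - b) - (- a * s) * (a * (r * (2 - y))) = 1"
    using sr nrm by algebra+
  have det: "p * q' - q * p' = 1"
    unfolding p_def q_def p'_def q'_def using d1 d2 by algebra
  have U: "s * (p * s) + (r - s) * (s * (p + q * r)) = 1 - t * a * (a - b)"
    unfolding p_def q_def t_def using sr nrm by algebra
  show ?thesis
    unfolding 3 mat_pow_chebS[OF det tr]
    unfolding A_def B_def mat22_mult riley_functional_mat22
    using U sr by algebra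
qed


section \<open>The words of the double twist knots\<close>

lemma letter_mat_alternating:
  fixes p q y s
  defines "r \<equiv> inverse s"
  assumes "s \<noteq> 0" and "schubert_eps p q j = (- 1) ^ (j + k)"
  shows "letter_mat p q j s y =
    (if even k then (if odd j then mat22 r (-1) 0 s else mat22 s 0 (2 - y) r)
     else (if odd j then mat22 s 1 0 r else mat22 r 0 (y - 2) s))"
  using assms by (auto simp: letter_mat_cases minus_one_power_iff)

section \<open>Products of letters arranged in periodic blocks\<close>

lemma foldr_mat_append:
  "foldr (\<lambda>j M. F j ** M) (js @ ks) (mat 1) =
     foldr (\<lambda>j M. F j ** M) js (mat 1) ** foldr (\<lambda>j M. (F j :: complex^2^2) ** M) ks (mat 1)"
  by (induction js) (simp_all add: matrix_mul_assoc)

lemma mat_pow_Suc_right: "mat_pow M (Suc k) = mat_pow M k ** M"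
  by (induction k) (simp_all add: matrix_mul_assoc)

lemma foldr_mat_pow:
  assumes "\<And>i. i < k \<Longrightarrow> foldr (\<lambda>j M. F j ** M) [c + i * l..<c + Suc i * l] (mat 1) = X"
  shows "foldr (\<lambda>j M. F j ** M) [c..<c + k * l] (mat 1) = mat_pow X k"
  using assms
proof (induction k)
  case (Suc k)
  have "[c..<c + Suc k * l] = [c..<c + k * l] @ [c + k * l..<c + Suc k * l]"
    using upt_add_eq_append[of c "c + k * l" l] by (simp add: algebra_simps)
  then show ?case
    using Suc by (simp only: foldr_mat_append mat_pow_Suc_right lessI less_SucI)
qed simp

lemma foldr_mat_alternating:
  assumes "\<And>i. i < k \<Longrightarrow> F (c + 2 * i) = X" and "\<And>i. i < k \<Longrightarrow> F (Suc (c + 2 * i)) = Y"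
  shows "foldr (\<lambda>j M. F j ** M) [c..<c + k * 2] (mat 1) = mat_pow (X ** Y) k"
proof (rule foldr_mat_pow)
  fix i assume "i < k"
  have "[c + i * 2..<c + Suc i * 2] = [c + 2 * i, Suc (c + 2 * i)]"
    by (simp add: mult.commute)
  with assms[OF \<open>i < k\<close>]
  show "foldr (\<lambda>j M. F j ** M) [c + i * 2..<c + Suc i * 2] (mat 1) = X ** Y"
    by (simp add: mult.commute)
qed

lemma foldr_mat_double_alternating:
  assumes F: "\<And>k i. k < 2 * n \<Longrightarrow> i < m \<Longrightarrow>
      F (c + k * (2 * m) + 2 * i) = (if even k then X else X') \<and>
      F (Suc (c + k * (2 * m) + 2 * i)) = (if even k then Y else Y')"
  shows "foldr (\<lambda>j M. F j ** M) [c..<c + n * (4 * m)] (mat 1) =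
    mat_pow (mat_pow (X ** Y) m ** mat_pow (X' ** Y') m) n"
proof (rule foldr_mat_pow)
  fix i assume "i < n"
  define d where "d = c + i * (4 * m)"
  have "[c + i * (4 * m)..<c + Suc i * (4 * m)] = [d..<d + m * 2] @ [d + m * 2..<(d + m * 2) + m * 2]"
    using upt_add_eq_append[of d "d + m * 2" "m * 2"] by (simp add: d_def algebra_simps)
  moreover have "foldr (\<lambda>j M. F j ** M) [d..<d + m * 2] (mat 1) = mat_pow (X ** Y) m"
    by (rule foldr_mat_alternating; use F[of "2 * i"] \<open>i < n\<close> in \<open>simp add: d_def algebra_simps\<close>)
  moreover have "foldr (\<lambda>j M. F j ** M) [d + m * 2..<(d + m * 2) + m * 2] (mat 1) = mat_pow (X' ** Y') m"
    by (rule foldr_mat_alternating; use F[of "Suc (2 * i)"] \<open>i < n\<close> in \<open>simp add: d_def algebra_simps\<close>)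
  ultimately show "foldr (\<lambda>j M. F j ** M) [c + i * (4 * m)..<c + Suc i * (4 * m)] (mat 1) =
      mat_pow (X ** Y) m ** mat_pow (X' ** Y') m"
    by (simp only: foldr_mat_append)
qed

text \<open>For \<open>q = p - 2n\<close> the floor of \<open>j q / p\<close> is \<open>j\<close>
  minus the ceiling of \<open>2 n j / p\<close>. That ceiling is \<open>Suc k\<close>, which is why
  the remainder \<open>e\<close> runs from 1 to \<open>p\<close> and not from 0 to
  \<open>p - 1\<close>.\<close>

lemma schubert_eps_eq:
  assumes "0 < e" "e \<le> p" "2 * n * j = p * k + e" "k < j" "2 * n \<le> p"
  shows "schubert_eps p (p - 2 * n) j = (- 1) ^ (j + Suc k)"
proof -
  obtain i where i: "j = Suc (k + i)" using assms(4) less_iff_Suc_add by auto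
  obtain d where d: "p = 2 * n + d" using assms(5) le_iff_add by auto
  have "j * d + 2 * n * j = j * p" by (simp add: d algebra_simps)
  then have "j * d + (p * k + e) = p * k + (i * p + p)"
    unfolding assms(3) by (simp add: i algebra_simps)
  then have "j * (p - 2 * n) = i * p + (p - e)" using assms(2) d by simp
  moreover have "(i * p + (p - e)) div p = i"
    using assms by (intro div_nat_eqI) (auto simp: algebra_simps)
  ultimately show ?thesis
    by (simp add: schubert_eps_def i minus_one_power_iff)
qed

lemma riley_tilde_minus:
  fixes M N :: nat and s y :: complex
  defines "m \<equiv> Suc M" and "n \<equiv> Suc N"
  defines "t \<equiv> y + 2 - (s + inverse s)^2"
  defines "z \<equiv> 2 + (y - 2) * t * chebS m y ^ 2"
  assumes s: "s \<noteq> 0"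
  shows "riley_tilde (4*m*n + 1) (4*m*n - 2*n + 1) s y =
    chebS (Suc n) z - chebS n z + t * chebS m y * (chebS m y - chebS M y) * chebS n z"
proof -
  define p where "p = 4*m*n + 1"
  have "2 * n \<le> 4 * m * n" by (rule mult_le_mono1) (simp add: m_def)
  then have n2: "2 * n \<le> p" and q: "4*m*n - 2*n + 1 = p - 2 * n"
    unfolding p_def by linarith+
  \<comment> \<open>The \<open>4mn\<close> letters form \<open>2n\<close> blocks of length
    \<open>2m\<close>, counted from index 1; in block \<open>k\<close> the remainder is
    \<open>2n(i + 1) - k\<close>, positive because \<open>k < 2n\<close>.\<close>
  have eps: "schubert_eps p (p - 2 * n) (Suc (k * (2 * m) + i)) = (- 1) ^ (Suc (k * (2 * m) + i) + Suc k)"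
    if "k < 2 * n" "i < 2 * m" for k i
  proof -
    have le: "2 * n * Suc i \<le> 4 * m * n"
      using mult_le_mono2[of "Suc i" "2 * m" "2 * n"] that by (simp add: mult_ac)
    have ge: "2 * n \<le> 2 * n * Suc i" by simp
    have 1: "k < Suc (k * (2 * m) + i)" by (simp add: m_def)
    have 2: "2 * n * Suc (k * (2 * m) + i) = p * k + (2 * n * Suc i - k)"
      using that by (simp add: p_def algebra_simps)
    have 3: "0 < 2 * n * Suc i - k" using ge that by linarith
    have 4: "2 * n * Suc i - k \<le> p" using le unfolding p_def by linarith
    show ?thesis by (rule schubert_eps_eq[OF 3 4 2 1 n2])
  qed
  define r where "r = inverse s"
  have sr: "s * r = 1" using s by (simp add: r_def)
  have "riley_W p (p - 2 * n) s y =
    foldr (\<lambda>j M. letter_mat p (p - 2 * n) j s y ** M) [1..<1 + n * (4 * m)] (mat 1)"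
    unfolding riley_W_block block_mat_def by (simp add: p_def algebra_simps)
  also have "\<dots> = mat_pow (mat_pow (mat22 s 1 0 r ** mat22 r 0 (y - 2) s) m **
      mat_pow (mat22 r (-1) 0 s ** mat22 s 0 (2 - y) r) m) n"
  proof (rule foldr_mat_double_alternating)
    fix k i assume ki: "k < 2 * n" "i < m"
    show "letter_mat p (p - 2 * n) (1 + k * (2 * m) + 2 * i) s y =
          (if even k then mat22 s 1 0 r else mat22 r (-1) 0 s) \<and>
        letter_mat p (p - 2 * n) (Suc (1 + k * (2 * m) + 2 * i)) s y =
          (if even k then mat22 r 0 (y - 2) s else mat22 s 0 (2 - y) r)"
      using letter_mat_alternating[OF s eps[of k "2 * i"], of y]
        letter_mat_alternating[OF s eps[of k "Suc (2 * i)"], of y] ki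
      by (simp add: r_def)
  qed
  finally have W: "riley_W p (p - 2 * n) s y = \<dots>" .
  have "riley_tilde p (p - 2 * n) s y = riley_functional (riley_W p (p - 2 * n) s y) s r"
    by (simp only: riley_tilde_def riley_functional_def r_def)
  also have "\<dots> = chebS (Suc n) z - chebS n z + t * chebS m y * (chebS m y - chebS M y) * chebS n z"
    unfolding W unfolding m_def n_def z_def t_def r_def[symmetric] by (rule riley_functional_minus[OF sr])
  finally show ?thesis unfolding q p_def .
qed

lemma riley_tilde_plus:
  fixes M N :: nat and s y :: complex
  defines "m \<equiv> Suc M" and "n \<equiv> Suc N"
  defines "t \<equiv> y + 2 - (s + inverse s)^2"
  defines "z \<equiv> 2 + (y - 2) * t * chebS m y ^ 2"
  assumes s: "s \<noteq> 0"
  shows "riley_tilde (4*m*n - 1) (4*m*n - 2*n - 1) s y =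
    chebS n z - chebS N z - t * chebS m y * (chebS m y - chebS M y) * chebS n z"
proof -
  define p where "p = 4*m*n - 1"
  have n_pos: "0 < n" by (simp add: n_def)
  have "3 * n \<le> 4 * m * n" by (rule mult_le_mono1) (simp add: m_def)
  then have n2: "2 * n \<le> p" and q: "4*m*n - 2*n - 1 = p - 2 * n" and p: "4*m*n = Suc p"
    using n_pos unfolding p_def by linarith+
  \<comment> \<open>Since \<open>p + 1 = 4mn\<close>, the blocks now start at index 0 and the
    remainder is \<open>k + 2ni\<close>. Index 0 itself is excluded: its remainder would be
    0.\<close>
  have eps: "schubert_eps p (p - 2 * n) (k * (2 * m) + i) = (- 1) ^ (k * (2 * m) + i + Suc k)"
    if "k < 2 * n" "i < 2 * m" "0 < k * (2 * m) + i" for k i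
  proof -
    have le: "2 * n * Suc i \<le> 2 * n * (2 * m)" using that by (intro mult_le_mono2) simp
    then have 3: "k + 2 * n * i \<le> p" using that p by (simp add: algebra_simps)
    have 1: "k < k * (2 * m) + i" using that by (cases "k = 0") (auto simp: m_def)
    have "k * (4*m*n) = k * Suc p" by (simp add: p)
    then have 2: "2 * n * (k * (2 * m) + i) = p * k + (k + 2 * n * i)"
      by (simp add: algebra_simps)
    show ?thesis
      by (rule schubert_eps_eq[OF _ 3 2 1 n2]) (use that n_pos in \<open>cases "k = 0"; simp\<close>)
  qed
  have p2: "2 * n * (2 * m) = Suc p" unfolding p[symmetric] by simp
  define r where "r = inverse s"
  have sr: "s * r = 1" using s by (simp add: r_def)
  define A B A' B' where "A = mat22 s 1 0 r" and "B = mat22 s 0 (2 - y) r"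
    and "A' = mat22 r (-1) 0 s" and "B' = mat22 r 0 (y - 2) s"
  \<comment> \<open>The exponent rule extended to \<open>j = 0\<close> and \<open>j = p\<close> completes \<open>w\<close> to \<open>b\<^sup>-\<^sup>1 w a\<^sup>-\<^sup>1\<close>, which is a power.\<close>
  define F where "F j = (if j = 0 then B' else if j = p then A' else letter_mat p (p - 2 * n) j s y)" for j
  have F: "foldr (\<lambda>j M. F j ** M) [0..<0 + n * (4 * m)] (mat 1) =
      mat_pow (mat_pow (B' ** A) m ** mat_pow (B ** A') m) n"
  proof (rule foldr_mat_double_alternating)
    fix k i assume ki: "k < 2 * n" "i < m"
    have "Suc k * (2 * m) \<le> 2 * n * (2 * m)" using ki by (intro mult_le_mono1) linarith
    then have le: "k * (2 * m) + 2 * m \<le> Suc p" unfolding p2 by simp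
    have "F (0 + k * (2 * m) + 2 * i) = (if even k then B' else B)"
    proof (cases "k * (2 * m) + 2 * i = 0")
      case True
      then show ?thesis by (simp add: F_def m_def)
    next
      case False
      moreover have "k * (2 * m) + 2 * i \<noteq> p" using le ki by linarith
      ultimately show ?thesis
        using letter_mat_alternating[OF s eps[of k "2 * i"], of y] ki
        by (simp add: F_def r_def B_def B'_def)
    qed
    moreover have "F (Suc (0 + k * (2 * m) + 2 * i)) = (if even k then A else A')"
    proof (cases "Suc (k * (2 * m) + 2 * i) = p")
      case True
      \<comment> \<open>Index \<open>p\<close> closes the last block, \<open>k = 2n - 1\<close>, so
        the added letter \<open>A'\<close> fits the pattern.\<close>
      have "odd k"
      proof -
        have "2 * n * (2 * m) \<le> k * (2 * m) + 2 * m" using True ki unfolding p2 by linarith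
        then have "2 * n * (2 * m) \<le> Suc k * (2 * m)" by simp
        then have "2 * n \<le> Suc k" unfolding mult_le_cancel2 by (simp add: m_def)
        then have "2 * n = Suc k" using ki by linarith
        then show ?thesis by presburger
      qed
      then show ?thesis using True n2 by (simp add: F_def)
    next
      case False
      then show ?thesis
        using letter_mat_alternating[OF s eps[of k "Suc (2 * i)"], of y] ki
        by (simp add: F_def r_def A_def A'_def)
    qed
    ultimately show "F (0 + k * (2 * m) + 2 * i) = (if even k then B' else B) \<and>
        F (Suc (0 + k * (2 * m) + 2 * i)) = (if even k then A else A')" ..
  qed
  have "n * (4 * m) = Suc p" unfolding p[symmetric] by simp
  moreover have "[0..<p] = 0 # [1..<p]"
    using n2 n_pos upt_conv_Cons[of 0 p] by simp
  ultimately have "[0..<0 + n * (4 * m)] = [0] @ [1..<p] @ [p]"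
    by simp
  then have "foldr (\<lambda>j M. F j ** M) [0..<0 + n * (4 * m)] (mat 1) =
      F 0 ** foldr (\<lambda>j M. F j ** M) [1..<p] (mat 1) ** F p"
    by (simp only: foldr_mat_append) (simp add: matrix_mul_assoc)
  moreover have "foldr (\<lambda>j M. F j ** M) [1..<p] (mat 1) = riley_W p (p - 2 * n) s y"
    unfolding riley_W_block block_mat_def by (rule foldr_cong) (auto simp: F_def)
  moreover have "F 0 = B'" "F p = A'" using n2 n_pos by (auto simp: F_def)
  ultimately have "mat_pow (mat_pow (B' ** A) m ** mat_pow (B ** A') m) n =
      B' ** riley_W p (p - 2 * n) s y ** A'"
    unfolding F by (simp only:)
  then have "B ** mat_pow (mat_pow (B' ** A) m ** mat_pow (B ** A') m) n ** A =
      B ** (B' ** riley_W p (p - 2 * n) s y ** A') ** A"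
    by (simp only:)
  also have "\<dots> = (B ** B') ** riley_W p (p - 2 * n) s y ** (A' ** A)"
    by (simp only: matrix_mul_assoc)
  also have BB: "B ** B' = mat 1"
    using sr by (simp add: B_def B'_def mat_1_mat22 algebra_simps)
  also have AA: "A' ** A = mat 1"
    using sr by (simp add: A_def A'_def mat_1_mat22 algebra_simps)
  finally have "riley_W p (p - 2 * n) s y =
      B ** mat_pow (mat_pow (B' ** A) m ** mat_pow (B ** A') m) n ** A"
    by (simp only: matrix_mul_lid matrix_mul_rid)
  then have "riley_tilde p (p - 2 * n) s y =
      riley_functional (B ** mat_pow (mat_pow (B' ** A) m ** mat_pow (B ** A') m) n ** A) s r"
    by (simp only: riley_tilde_def riley_functional_def r_def)
  also have "\<dots> = chebS n z - chebS N z - t * chebS m y * (chebS m y - chebS M y) * chebS n z"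
    unfolding A_def A'_def B_def B'_def m_def n_def z_def t_def r_def[symmetric]
    by (rule riley_functional_plus[OF sr])
  finally show ?thesis unfolding q p_def .
qed


section \<open>Real zeros\<close>

text \<open>For \<open>y = 2 cos t\<close> the difference
  \<open>chebS (Suc k) y - y / 2 * chebS k y\<close> is \<open>cos (k t)\<close>; completing the
  square in \<open>chebS_norm\<close> bounds it by 1, so each step adds at most 1.\<close>

lemma chebS_abs_le:
  fixes y :: real
  assumes "\<bar>y\<bar> \<le> 2"
  shows "\<bar>chebS k y\<bar> \<le> real k"
proof (induction k)
  case (Suc k)
  let ?s = "chebS k y" and ?s' = "chebS (Suc k) y"
  have y2: "y\<^sup>2 \<le> 4" using assms abs_le_square_iff[of y 2] by simp
  have "4 * (?s' - y / 2 * ?s)\<^sup>2 = 4 - (4 - y\<^sup>2) * ?s\<^sup>2"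
    using chebS_norm[of k y] by algebra
  moreover have "0 \<le> (4 - y\<^sup>2) * ?s\<^sup>2" using y2 by simp
  ultimately have "(?s' - y / 2 * ?s)\<^sup>2 \<le> 1" by linarith
  then have 1: "\<bar>?s' - y / 2 * ?s\<bar> \<le> 1" by (simp add: abs_square_le_1)
  have "\<bar>y / 2 * ?s\<bar> \<le> 1 * \<bar>?s\<bar>"
    unfolding abs_mult using assms by (intro mult_right_mono) auto
  with 1 Suc show ?case by linarith
qed simp

lemma chebS_step:
  fixes y :: real
  assumes "2 \<le> y"
  shows "0 \<le> chebS k y" "chebS k y + 1 \<le> chebS (Suc k) y"
proof -
  have "0 \<le> chebS k y \<and> chebS k y + 1 \<le> chebS (Suc k) y"
  proof (induction k)
    case (Suc k)
    have "2 * chebS (Suc k) y \<le> y * chebS (Suc k) y" using Suc assms by (intro mult_right_mono) auto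
    then show ?case using Suc unfolding chebS.simps by linarith
  qed simp
  then show "0 \<le> chebS k y" "chebS k y + 1 \<le> chebS (Suc k) y" by auto
qed

lemma chebS_mono:
  fixes y y' :: real
  assumes "2 \<le> y" "y \<le> y'"
  shows "chebS k y \<le> chebS k y'"
proof -
  have "chebS k y \<le> chebS k y' \<and>
      chebS (Suc k) y - chebS k y \<le> chebS (Suc k) y' - chebS k y'"
  proof (induction k)
    case (Suc k)
    then have le: "chebS (Suc k) y \<le> chebS (Suc k) y'" by linarith
    have "(y - 2) * chebS (Suc k) y \<le> (y' - 2) * chebS (Suc k) y'"
      using assms le chebS_step(1)[of y "Suc k"] by (intro mult_mono) auto
    then show ?case using Suc le by (simp add: algebra_simps)
  qed simp
  then show ?thesis ..
qed

lemma continuous_on_chebS [continuous_intros]: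
  fixes f :: "real \<Rightarrow> real"
  assumes "continuous_on S f"
  shows "continuous_on S (\<lambda>y. chebS k (f y))"
proof -
  have "continuous_on S (\<lambda>y. chebS k (f y)) \<and> continuous_on S (\<lambda>y. chebS (Suc k) (f y))"
    by (induction k) (auto intro!: continuous_intros assms)
  then show ?thesis ..
qed

text \<open>For \<open>y = 2 cosh \<xi>\<close> and \<open>m = k + 1\<close> one has \<open>1 + 2 / cheb_quot k y = coth (m \<xi>) coth (\<xi> / 2)\<close>.\<close>

definition cheb_quot :: "nat \<Rightarrow> real \<Rightarrow> real" where
  "cheb_quot k y = (y - 2) * chebS (Suc k) y / (chebS (Suc k) y - chebS k y)"

text \<open>Since \<open>q / (1 + q)\<close> increases for \<open>q > 0\<close>, this recursion
  carries monotonicity in \<open>y\<close> from \<open>k\<close> to \<open>Suc k\<close>.\<close>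

lemma cheb_quot_Suc:
  assumes "2 < y"
  shows "cheb_quot (Suc k) y = cheb_quot k y / (1 + cheb_quot k y) + (y - 2)"
proof -
  define a d where "a = chebS (Suc k) y" and "d = chebS (Suc k) y - chebS k y"
  have pos: "0 < d" "0 < a" "0 < d + (y - 2) * a"
    using chebS_step[of y k] assms by (auto simp: a_def d_def add_pos_pos)
  have q: "cheb_quot k y = (y - 2) * a / d" by (simp add: cheb_quot_def a_def d_def)
  define e where "e = d + (y - 2) * a"
  have e: "0 < e" using pos by (simp add: e_def)
  have "cheb_quot (Suc k) y = (y - 2) * (a + e) / e"
    by (simp add: cheb_quot_def a_def d_def e_def algebra_simps)
  also have "\<dots> = (y - 2) * a / e + (y - 2)"
    using e by (simp add: field_simps)
  also have "(y - 2) * a / e = cheb_quot k y / (1 + cheb_quot k y)"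
  proof -
    have "1 + (y - 2) * a / d = e / d" using pos by (simp add: e_def add_divide_distrib)
    then show ?thesis unfolding q using pos by simp
  qed
  finally show ?thesis .
qed

lemma cheb_quot_pos: "2 < y \<Longrightarrow> 0 < cheb_quot k y"
  unfolding cheb_quot_def using chebS_step[of y k] by (intro divide_pos_pos mult_pos_pos) auto

lemma cheb_quot_strict_mono:
  assumes "2 < y" "y < y'"
  shows "cheb_quot k y < cheb_quot k y'"
proof (induction k)
  case 0
  show ?case using assms by (simp add: cheb_quot_def)
next
  case (Suc k)
  have "cheb_quot k y / (1 + cheb_quot k y) \<le> cheb_quot k y' / (1 + cheb_quot k y')"
    using Suc cheb_quot_pos[of y k] assms by (simp add: field_simps)
  then show ?case using assms by (simp add: cheb_quot_Suc)
qed

section \<open>Identities at a zero and the half-line \<open>u \<le> 0\<close>\<close>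

text \<open>Dividing \<open>zero\<close> by \<open>A * v\<close> shows that \<open>(A, B, v)\<close>
  has the same quotient \<open>g\<close> as \<open>(a, b, u)\<close>. Substituting
  \<open>b = a (1 - g u)\<close> in the norm identity and dividing by \<open>a^2\<close> leaves an
  equation in \<open>u\<close>, \<open>\<rho>\<close> and \<open>1 / a^2\<close>; eliminating
  \<open>a^2\<close> from the definition of \<open>v\<close> then yields \<open>c\<close>.\<close>

lemma zero_curve:
  fixes a b A B u c :: real
  defines "v \<equiv> u * (u + c) * a\<^sup>2" and "g \<equiv> (a - b) / (a * u)"
  defines "\<rho> \<equiv> 4 * g * (1 + g)"
  assumes nrm: "a\<^sup>2 - (2 + u) * a * b + b\<^sup>2 = 1" "A\<^sup>2 - (2 + v) * A * B + B\<^sup>2 = 1"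
    and zero: "A - B = (u + c) * a * (a - b) * A"
    and nz: "v \<noteq> 0"
  shows "A \<noteq> 0" "g = (A - B) / (A * v)" "- 1 \<le> \<rho>"
    "u * (\<rho> * u - 4) / 4 = 1 / a\<^sup>2" "v * (\<rho> * v - 4) / 4 = 1 / A\<^sup>2"
    "c = \<rho> * u * v / 4 - u - v"
proof -
  have nz': "u \<noteq> 0" "u + c \<noteq> 0" "a \<noteq> 0" using nz by (auto simp: v_def)
  show A: "A \<noteq> 0" using nrm(2) zero by auto
  have inv: "w * (4 * ((p - q) / (p * w)) * (1 + (p - q) / (p * w)) * w - 4) / 4 = 1 / p\<^sup>2"
    if "w \<noteq> 0" "p \<noteq> 0" "p\<^sup>2 - (2 + w) * p * q + q\<^sup>2 = 1" for w p q :: real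
  proof -
    have "w * (4 * ((p - q) / (p * w)) * (1 + (p - q) / (p * w)) * w - 4) / 4
        = (p\<^sup>2 - (2 + w) * p * q + q\<^sup>2) / p\<^sup>2"
      using that(1,2) by (simp add: field_simps power2_eq_square)
    then show ?thesis using that(3) by simp
  qed
  show a: "u * (\<rho> * u - 4) / 4 = 1 / a\<^sup>2"
    unfolding \<rho>_def g_def by (rule inv[OF nz'(1,3) nrm(1)])
  have "(A - B) / (A * v) = (u + c) * a * (a - b) / v" unfolding zero using A by simp
  also have "t * a * d / (u * t * a\<^sup>2) = d / (a * u)" if "t \<noteq> 0" for t d
    using nz' that by (simp add: power2_eq_square)
  from this[OF nz'(2)] have "(u + c) * a * (a - b) / v = g" unfolding v_def g_def .
  finally show g: "g = (A - B) / (A * v)" ..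
  show "v * (\<rho> * v - 4) / 4 = 1 / A\<^sup>2"
    unfolding \<rho>_def g by (rule inv[OF nz A nrm(2)])
  have "\<rho> = (2 * g + 1)\<^sup>2 - 1" by (simp add: \<rho>_def algebra_simps power2_eq_square)
  then show "- 1 \<le> \<rho>" by simp
  have "u + c = v / (u * a\<^sup>2)" using nz' by (simp add: v_def)
  also have "\<dots> = v / u * (1 / a\<^sup>2)" by simp
  also have "\<dots> = v * (\<rho> * u - 4) / 4" unfolding a[symmetric] using nz' by simp
  finally show "c = \<rho> * u * v / 4 - u - v" by (simp add: algebra_simps)
qed

text \<open>The square of the right-hand side exceeds the product by
  \<open>U^2 + V^2 + U V + \<rho> U V (U + V) / 4\<close>, which is positive because
  \<open>-1 \<le> \<rho>\<close> and \<open>U + V \<le> 2\<close>. It serves with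
  \<open>U = - u\<close>, \<open>V = - v\<close>, where the right-hand side is
  \<open>c\<close>.\<close>

lemma product_bound:
  fixes \<rho> U V K :: real
  assumes "- 1 \<le> \<rho>" "0 < U" "U \<le> 1" "0 < V" "V \<le> 1" "0 < K"
    and "K\<^sup>2 \<le> (\<rho> * U\<^sup>2 / 4 + U) * (\<rho> * V\<^sup>2 / 4 + V)"
  shows "K < \<rho> * U * V / 4 + U + V"
proof -
  have UV: "0 < U * V" "U * V \<le> U" "U * V \<le> V" using assms by (auto simp: mult_le_cancel_left1 mult_le_cancel_right1)
  have ge: "- (U * V) \<le> \<rho> * (U * V)" using mult_right_mono[OF assms(1), of "U * V"] UV by simp
  then have S: "0 \<le> \<rho> * U * V / 4 + U + V" using UV by (simp add: mult.assoc)
  define P where "P = (U * V) * (U + V)"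
  have "0 \<le> P" using UV assms by (simp add: P_def)
  then have P1: "- P \<le> \<rho> * P" using mult_right_mono[OF assms(1)] by fastforce
  have P2: "P \<le> (U * V) * 2" unfolding P_def using assms UV by (intro mult_left_mono) auto
  have "(\<rho> * U * V / 4 + U + V)\<^sup>2 = (\<rho> * U\<^sup>2 / 4 + U) * (\<rho> * V\<^sup>2 / 4 + V)
      + (U\<^sup>2 + V\<^sup>2 + U * V + \<rho> * P / 4)"
    by (simp add: P_def field_simps power2_eq_square)
  moreover have "0 < U\<^sup>2 + V\<^sup>2" using assms by (intro add_pos_pos) auto
  then have "0 < U\<^sup>2 + V\<^sup>2 + U * V + \<rho> * P / 4" using P1 P2 UV by linarith
  ultimately have "K\<^sup>2 < (\<rho> * U * V / 4 + U + V)\<^sup>2" using assms(7) by linarith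
  then show ?thesis by (rule power2_less_imp_less[OF _ S])
qed

lemma no_zero_nonpos:
  fixes u c a b A B :: real and m n :: nat
  defines "v \<equiv> u * (u + c) * a\<^sup>2"
  assumes nrm: "a\<^sup>2 - (2 + u) * a * b + b\<^sup>2 = 1" "A\<^sup>2 - (2 + v) * A * B + B\<^sup>2 = 1"
    and zero: "A - B = (u + c) * a * (a - b) * A"
    and u: "u \<le> 0" and c: "0 \<le> c" "c * (real m * real n) < 1" and mn: "0 < m" "0 < n"
    and a: "- 4 \<le> u \<Longrightarrow> \<bar>a\<bar> \<le> real m" and A: "- 4 \<le> v \<Longrightarrow> v \<le> 0 \<Longrightarrow> \<bar>A\<bar> \<le> real n"
  shows False
proof (cases "v = 0")
  case True
  then have AB: "(A - B)\<^sup>2 = 1" using nrm(2) by (simp add: power2_eq_square algebra_simps)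
  have "A - B \<noteq> 0" using AB by auto
  with zero have nz: "u + c \<noteq> 0" "a \<noteq> 0" by auto
  with True have u0: "u = 0" by (simp add: v_def)
  then have ab: "(a - b)\<^sup>2 = 1" using nrm(1) by (simp add: power2_eq_square algebra_simps)
  have 1: "\<bar>A - B\<bar> = 1" "\<bar>a - b\<bar> = 1"
    using AB ab unfolding power2_eq_1_iff by auto
  have "\<bar>A - B\<bar> = \<bar>u + c\<bar> * \<bar>a\<bar> * \<bar>a - b\<bar> * \<bar>A\<bar>" unfolding zero by (simp add: abs_mult)
  then have "1 = c * (\<bar>a\<bar> * \<bar>A\<bar>)" using 1 u0 c by simp
  also have "\<dots> \<le> c * (real m * real n)"
    using a A u0 True c by (intro mult_left_mono mult_mono) auto
  finally show False using c by simp
next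
  case False
  define g where "g = (a - b) / (a * u)"
  define \<rho> where "\<rho> = 4 * g * (1 + g)"
  note Z = zero_curve[OF nrm(1) nrm(2)[unfolded v_def] zero False[unfolded v_def],
      folded v_def, folded g_def, folded \<rho>_def]
  have nz: "u \<noteq> 0" "a \<noteq> 0" using False by (auto simp: v_def)
  have u0: "u < 0" using u nz by simp
  show False
  proof (cases "v > 0")
    case True
    have "0 < v * (\<rho> * v - 4) / 4" unfolding Z(5) using Z(1) by simp
    then have "0 < \<rho> * v - 4" using True by (simp add: zero_less_mult_iff)
    then have "u * (\<rho> * v - 4) / 4 < 0" using u0 by (simp add: mult_neg_pos)
    moreover have "c = u * (\<rho> * v - 4) / 4 - v" unfolding Z(6) by (simp add: algebra_simps)
    ultimately show False using True c by linarith
  next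
    case v: False
    then have v0: "v < 0" using False by simp
    have c1: "c < 1"
    proof -
      have "1 \<le> real m * real n" using mn mult_mono[of 1 "real m" 1 "real n"] by simp
      then have "c * 1 \<le> c * (real m * real n)" using c by (intro mult_left_mono) auto
      then show ?thesis using c by simp
    qed
    have "0 < a\<^sup>2" using nz by simp
    then have "0 < u + c" using v0 u0 unfolding v_def by (simp add: mult_less_0_iff)
    then have uc: "- c < u" by simp
    have am: "\<bar>a\<bar> \<le> real m" using a uc c1 by simp
    \<comment> \<open>Both \<open>- u\<close> and \<open>u + c\<close> lie between 0 and
      \<open>c\<close>, so \<open>- v\<close> is at most \<open>(c m)^2\<close>, and
      \<open>c m \<le> c m n < 1\<close>. This opens both the bound on \<open>A\<close> and
      \<open>product_bound\<close>.\<close>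
    have "- v \<le> 1"
    proof -
      have am2: "a\<^sup>2 \<le> (real m)\<^sup>2" using am abs_le_square_iff[of a "real m"] by simp
      have cm: "c * real m \<le> c * (real m * real n)" using c mn by (intro mult_left_mono) auto
      have "- u * (u + c) \<le> c * c" using uc u0 c by (intro mult_mono) auto
      then have "- u * (u + c) * a\<^sup>2 \<le> c * c * (real m)\<^sup>2"
        using am2 c uc u0 by (intro mult_mono) auto
      also have "\<dots> = (c * real m)\<^sup>2" by (simp add: power2_eq_square)
      also have "\<dots> \<le> 1" using cm c by (simp add: abs_square_le_1)
      finally show ?thesis by (simp add: v_def)
    qed
    then have An: "\<bar>A\<bar> \<le> real n" using A v0 by simp
    define K where "K = 1 / (\<bar>a\<bar> * \<bar>A\<bar>)"
    have K: "0 < K" using nz Z(1) by (simp add: K_def)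
    have "K\<^sup>2 = (1 / a\<^sup>2) * (1 / A\<^sup>2)" by (simp add: K_def power_mult_distrib power_divide)
    also have "\<dots> = (\<rho> * (- u)\<^sup>2 / 4 + (- u)) * (\<rho> * (- v)\<^sup>2 / 4 + (- v))"
      unfolding Z(4)[symmetric] Z(5)[symmetric] by algebra
    finally have "K\<^sup>2 \<le> (\<rho> * (- u)\<^sup>2 / 4 + (- u)) * (\<rho> * (- v)\<^sup>2 / 4 + (- v))" by simp
    then have "K < \<rho> * (- u) * (- v) / 4 + (- u) + (- v)"
      using Z(3) u0 uc c1 v0 \<open>- v \<le> 1\<close> K by (intro product_bound) auto
    then have Kc: "K < c" unfolding Z(6) by simp
    have "\<bar>a\<bar> * \<bar>A\<bar> \<le> real m * real n" using am An by (intro mult_mono) auto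
    then have "K * (\<bar>a\<bar> * \<bar>A\<bar>) \<le> c * (real m * real n)"
      by (rule mult_mono[OF less_imp_le[OF Kc]]) (use c in auto)
    moreover have "K * (\<bar>a\<bar> * \<bar>A\<bar>) = 1" using nz Z(1) by (simp add: K_def)
    ultimately show False using c by simp
  qed
qed

text \<open>With \<open>w = sqrt \<rho>\<close>, \<open>q = w u / 2 - 2 / w\<close> and \<open>q' = w v / 2 - 2 / w\<close> the constant is
  \<open>q q' - 4 / \<rho>\<close>, and \<open>q (q + 2 / w) = u (\<rho> u - 4) / 4\<close> shows that \<open>q\<close> increases with \<open>\<rho>\<close>.\<close>

lemma curve_constant_mono:
  fixes \<rho> \<rho>' u u' v v' c c' :: real
  assumes \<rho>: "0 < \<rho>'" "\<rho>' < \<rho>"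
    and pos: "0 < u" "0 < u'" "0 < v" "0 < v'"
    and u: "0 < u' * (\<rho>' * u' - 4)" "u' * (\<rho>' * u' - 4) \<le> u * (\<rho> * u - 4)"
    and v: "0 < v' * (\<rho>' * v' - 4)" "v' * (\<rho>' * v' - 4) \<le> v * (\<rho> * v - 4)"
  shows "\<rho>' * u' * v' / 4 - u' - v' < \<rho> * u * v / 4 - u - v"
proof -
  define w w' where "w = sqrt \<rho>" and "w' = sqrt \<rho>'"
  have w: "0 < w'" "w' < w" and w2: "w * w = \<rho>" "w' * w' = \<rho>'"
    using \<rho> by (auto simp: w_def w'_def)
  define q where "q r x = r * x / 2 - 2 / r" for r x :: real
  have q_eq: "q r x * (q r x + 2 / r) = x * (r * r * x - 4) / 4" if "0 < r" for r x
    using that by (simp add: q_def field_simps)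
  have q_pos: "0 < q r x" if "0 < r" "0 < x" "0 < x * (r * r * x - 4)" for r x
  proof -
    have "4 < r * r * x" using that by (simp add: zero_less_mult_iff)
    then show ?thesis using that by (simp add: q_def field_simps)
  qed
  have q_less: "q w' x' < q w x" if "0 < x" "0 < x'" "0 < x' * (\<rho>' * x' - 4)"
      "x' * (\<rho>' * x' - 4) \<le> x * (\<rho> * x - 4)" for x x'
  proof (rule ccontr)
    assume "\<not> q w' x' < q w x"
    then have le: "q w x \<le> q w' x'" by simp
    have p: "0 < q w x" "0 < q w' x'" using q_pos that w w2 by auto
    have "2 / w < 2 / w'" using w by (simp add: field_simps)
    then have "q w x * (q w x + 2 / w) < q w' x' * (q w' x' + 2 / w')"
      using le p w by (intro mult_le_less_imp_less) auto
    then show False using that w by (simp add: q_eq w2)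
  qed
  have eq: "r * r * x * x' / 4 - x - x' = q r x * q r x' - 4 / (r * r)" if "0 < r" for r x x'
    using that by (simp add: q_def field_simps)
  have "q w' u' * q w' v' < q w u * q w v"
    using q_less[OF pos(1,2) u] q_less[OF pos(3,4) v] q_pos[of w' u'] q_pos[of w' v'] pos u v w w2
    by (intro mult_strict_mono) auto
  moreover have "4 / (w * w) < 4 / (w' * w')"
    using w2 \<rho> by (simp add: field_simps)
  ultimately show ?thesis using eq[of w] eq[of w'] w unfolding w2 by simp
qed

section \<open>The Riley polynomials at real arguments\<close>

text \<open>The suffix \<open>plus\<close> belongs to J(2m,2n), where \<open>p = 4mn - 1\<close>,
  and \<open>minus\<close> to J(2m,-2n), where \<open>p = 4mn + 1\<close>; \<open>M\<close> and
  \<open>N\<close> stand for \<open>m - 1\<close> and \<open>n - 1\<close>.\<close>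

definition riley_plus :: "nat \<Rightarrow> nat \<Rightarrow> real \<Rightarrow> real \<Rightarrow> real" where
  "riley_plus M N x y =
     (let a = chebS (Suc M) y; b = chebS M y; t = y + 2 - x\<^sup>2; z = 2 + (y - 2) * t * a\<^sup>2
      in chebS (Suc N) z - chebS N z - t * a * (a - b) * chebS (Suc N) z)"

definition riley_minus :: "nat \<Rightarrow> nat \<Rightarrow> real \<Rightarrow> real \<Rightarrow> real" where
  "riley_minus M N x y =
     (let a = chebS (Suc M) y; b = chebS M y; t = y + 2 - x\<^sup>2; z = 2 + (y - 2) * t * a\<^sup>2
      in chebS (Suc (Suc N)) z - chebS (Suc N) z + t * a * (a - b) * chebS (Suc N) z)"

text \<open>A common divisor of \<open>p\<close> and \<open>p - 2n\<close> divides
  \<open>2n\<close>, hence \<open>4mn\<close>, which is a neighbour of \<open>p\<close>.\<close>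

lemma coprime_diff_double:
  assumes "4 * m * n = Suc p \<or> p = 4 * m * n + (1::nat)" "2 * n \<le> p"
  shows "coprime p (p - 2 * n)" "odd p" "odd (p - 2 * n)"
proof -
  have "even (4 * m * n)" by simp
  then show "odd p" using assms(1) by (metis even_Suc Suc_eq_plus1)
  then show "odd (p - 2 * n)" using assms(2) by simp
  show "coprime p (p - 2 * n)"
  proof (rule coprimeI)
    fix d assume d: "d dvd p" "d dvd p - 2 * n"
    then have "d dvd 2 * n" using assms(2) by (metis dvd_diff_nat diff_diff_cancel)
    then have "d dvd (2 * n) * (2 * m)" by (rule dvd_mult2)
    then have "d dvd 4 * m * n" by (simp add: mult_ac)
    from assms(1) show "is_unit d"
    proof
      assume "4 * m * n = Suc p"
      with d(1) \<open>d dvd 4 * m * n\<close> have "d dvd Suc p - p" by (metis dvd_diff_nat)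
      then show ?thesis by simp
    next
      assume "p = 4 * m * n + 1"
      with d(1) \<open>d dvd 4 * m * n\<close> have "d dvd p - 4 * m * n" by (metis dvd_diff_nat)
      then show ?thesis using \<open>p = 4 * m * n + 1\<close> by simp
    qed
  qed
qed

lemma eval2_riley_plus:
  fixes M N :: nat
  defines "m \<equiv> Suc M" and "n \<equiv> Suc N"
  shows "eval2 (riley_poly (4*m*n - 1) (4*m*n - 2*n - 1)) (complex_of_real x) (complex_of_real y)
    = complex_of_real (riley_plus M N x y)"
proof -
  define p where "p = 4*m*n - 1"
  have "0 < n" by (simp add: n_def)
  moreover have "3 * n \<le> 4 * m * n" by (rule mult_le_mono1) (simp add: m_def)
  ultimately have p: "2 * n \<le> p" "4*m*n - 2*n - 1 = p - 2 * n" "4*m*n = Suc p"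
    unfolding p_def by linarith+
  \<comment> \<open>For \<open>|x| < 2\<close> every such \<open>s\<close> is non-real, so the
    formula is used over the complex numbers and \<open>chebS_of_real\<close> brings it
    back.\<close>
  obtain s :: complex where s: "s \<noteq> 0" "s + inverse s = complex_of_real x"
    using joukowski_surj by blast
  have "eval2 (riley_poly p (p - 2 * n)) (complex_of_real x) (complex_of_real y)
      = riley_tilde p (p - 2 * n) s (complex_of_real y)"
    unfolding s(2)[symmetric]
    by (rule eval2_riley_poly[OF coprime_diff_double(2,3,1)[OF disjI1[OF p(3)] p(1)] s(1)])
  also have "\<dots> = complex_of_real (riley_plus M N x y)"
    using riley_tilde_plus[OF s(1), of M N "complex_of_real y"]
    unfolding m_def[symmetric] n_def[symmetric] p(2) p_def[symmetric] s(2)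
    by (simp add: riley_plus_def Let_def m_def n_def chebS_of_real[symmetric] del: chebS.simps)
  finally show ?thesis unfolding p(2) p_def .
qed

lemma eval2_riley_minus:
  fixes M N :: nat
  defines "m \<equiv> Suc M" and "n \<equiv> Suc N"
  shows "eval2 (riley_poly (4*m*n + 1) (4*m*n - 2*n + 1)) (complex_of_real x) (complex_of_real y)
    = complex_of_real (riley_minus M N x y)"
proof -
  define p where "p = 4*m*n + 1"
  have "2 * n \<le> 4 * m * n" by (rule mult_le_mono1) (simp add: m_def)
  then have p: "2 * n \<le> p" "4*m*n - 2*n + 1 = p - 2 * n"
    unfolding p_def by linarith+
  obtain s :: complex where s: "s \<noteq> 0" "s + inverse s = complex_of_real x"
    using joukowski_surj by blast
  have "eval2 (riley_poly p (p - 2 * n)) (complex_of_real x) (complex_of_real y)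
      = riley_tilde p (p - 2 * n) s (complex_of_real y)"
    unfolding s(2)[symmetric]
    by (rule eval2_riley_poly[OF coprime_diff_double(2,3,1)[OF disjI2[OF p_def] p(1)] s(1)])
  also have "\<dots> = complex_of_real (riley_minus M N x y)"
    using riley_tilde_minus[OF s(1), of M N "complex_of_real y"]
    unfolding m_def[symmetric] n_def[symmetric] p(2) p_def[symmetric] s(2)
    by (simp add: riley_minus_def Let_def m_def n_def chebS_of_real[symmetric] del: chebS.simps)
  finally show ?thesis unfolding p(2) p_def .
qed

lemma riley_nonzero_nonpos:
  fixes m n M N :: nat and x y :: real
  defines "m \<equiv> Suc M" and "n \<equiv> Suc N"
  assumes c: "0 \<le> 4 - x\<^sup>2" "(4 - x\<^sup>2) * (real m * real n) < 1" and y: "y \<le> 2"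
  shows "riley_plus M N x y \<noteq> 0" "riley_minus M N x y \<noteq> 0"
proof -
  define a b z where "a = chebS m y" and "b = chebS M y"
    and "z = 2 + (y - 2) * (y + 2 - x\<^sup>2) * a\<^sup>2"
  define u c' v where "u = y - 2" and "c' = 4 - x\<^sup>2" and "v = u * (u + c') * a\<^sup>2"
  have y': "y = 2 + u" and t: "y + 2 - x\<^sup>2 = u + c'" and z: "z = 2 + v"
    by (simp_all add: u_def c'_def v_def z_def algebra_simps)
  have nrm: "a\<^sup>2 - (2 + u) * a * b + b\<^sup>2 = 1"
    unfolding a_def b_def m_def y'[symmetric] by (rule chebS_norm)
  \<comment> \<open>\<open>B\<close> stays free so that one argument covers both polynomials: it
    becomes the Chebyshev value before or after \<open>chebS n z\<close>, and the norm is symmetric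
    in neighbours.\<close>
  have *: False if "(chebS n z)\<^sup>2 - (2 + v) * chebS n z * B + B\<^sup>2 = 1"
    "chebS n z - B = (u + c') * a * (a - b) * chebS n z" for B
  proof (rule no_zero_nonpos[OF nrm that(1)[unfolded v_def] that(2)])
    show "u \<le> 0" using y by (simp add: u_def)
    show "0 \<le> c'" "c' * (real m * real n) < 1" using c by (auto simp: c'_def)
    show "0 < m" "0 < n" by (auto simp: m_def n_def)
    show "\<bar>a\<bar> \<le> real m" if "- 4 \<le> u"
      unfolding a_def using that y by (intro chebS_abs_le) (simp add: u_def)
    show "\<bar>chebS n z\<bar> \<le> real n" if "- 4 \<le> u * (u + c') * a\<^sup>2" "u * (u + c') * a\<^sup>2 \<le> 0"
      using that unfolding v_def[symmetric] by (intro chebS_abs_le) (simp add: z)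
  qed
  have n1: "(chebS n z)\<^sup>2 - (2 + v) * chebS n z * chebS N z + (chebS N z)\<^sup>2 = 1"
    unfolding n_def z[symmetric] by (rule chebS_norm)
  have n2: "(chebS n z)\<^sup>2 - (2 + v) * chebS n z * chebS (Suc n) z + (chebS (Suc n) z)\<^sup>2 = 1"
    unfolding z[symmetric] using chebS_norm[of n z] by (simp add: algebra_simps)
  show "riley_plus M N x y \<noteq> 0"
  proof
    assume "riley_plus M N x y = 0"
    then have "chebS n z - chebS N z = (y + 2 - x\<^sup>2) * a * (a - b) * chebS n z"
      by (simp add: riley_plus_def Let_def flip: m_def n_def a_def b_def z_def)
    then show False using *[OF n1] unfolding t by blast
  qed
  show "riley_minus M N x y \<noteq> 0"
  proof
    assume "riley_minus M N x y = 0"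
    then have "chebS n z - chebS (Suc n) z = (y + 2 - x\<^sup>2) * a * (a - b) * chebS n z"
      by (simp add: riley_minus_def Let_def del: chebS.simps flip: m_def n_def a_def b_def z_def)
    then show False using *[OF n2] unfolding t by blast
  qed
qed

section \<open>The half-line \<open>y > 2\<close>: positivity, existence and uniqueness\<close>

lemma riley_minus_pos:
  assumes "x\<^sup>2 \<le> 4" "2 < y"
  shows "0 < riley_minus M N x y"
proof -
  define a b z where "a = chebS (Suc M) y" and "b = chebS M y"
    and "z = 2 + (y - 2) * (y + 2 - x\<^sup>2) * a\<^sup>2"
  have ab: "0 \<le> a" "0 \<le> a - b"
    using chebS_step[of y M] assms by (auto simp: a_def b_def)
  have z: "2 \<le> z" unfolding z_def using assms by simp
  have "0 \<le> (y + 2 - x\<^sup>2) * a * (a - b) * chebS (Suc N) z"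
    using ab chebS_step(1)[OF z] assms by (intro mult_nonneg_nonneg) auto
  moreover have "0 < chebS (Suc (Suc N)) z - chebS (Suc N) z"
    using chebS_step(2)[OF z, of "Suc N"] by linarith
  ultimately show ?thesis
    unfolding riley_minus_def Let_def by (fold a_def b_def, fold z_def) linarith
qed

lemma riley_plus_zero_ex:
  assumes "x\<^sup>2 \<le> 4" "(4 - x\<^sup>2) * (real (Suc M) * real (Suc N)) < 1"
  shows "\<exists>y. riley_plus M N x y = 0"
proof -
  \<comment> \<open>At \<open>y = 2\<close> also \<open>z = 2\<close>, and the value is
    \<open>1 - (4 - x^2) m n\<close>: here the hypothesis on \<open>x\<close> enters.\<close>
  have "0 \<le> riley_plus M N x 2"
    using assms(2) by (simp add: riley_plus_def chebS_two Let_def algebra_simps del: chebS.simps)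
  \<comment> \<open>At \<open>y = 3\<close> the factors \<open>5 - x^2\<close>, \<open>a\<close> and
    \<open>a - b\<close> are all at least 1, which leaves at most
    \<open>- chebS N z\<close>.\<close>
  moreover have "riley_plus M N x 3 \<le> 0"
  proof -
    define a b z where "a = chebS (Suc M) (3::real)" and "b = chebS M (3::real)"
      and "z = 2 + (3 - 2) * (3 + 2 - x\<^sup>2) * a\<^sup>2"
    have ab: "1 \<le> a" "1 \<le> a - b"
      using chebS_step[of 3 M] by (auto simp: a_def b_def)
    have z: "2 \<le> z" unfolding z_def using assms by simp
    have A: "0 \<le> chebS (Suc N) z" "0 \<le> chebS N z" using chebS_step(1)[OF z] by auto
    have "1 * 1 * 1 \<le> (3 + 2 - x\<^sup>2) * a * (a - b)"
      using ab assms by (intro mult_mono) auto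
    then have "1 * chebS (Suc N) z \<le> (3 + 2 - x\<^sup>2) * a * (a - b) * chebS (Suc N) z"
      using A by (intro mult_right_mono) auto
    then show ?thesis
      unfolding riley_plus_def Let_def by (fold a_def b_def, fold z_def) (use A in linarith)
  qed
  moreover have "continuous_on {2..3} (riley_plus M N x)"
    unfolding riley_plus_def Let_def by (intro continuous_intros)
  ultimately show ?thesis using IVT2'[of "riley_plus M N x" 3 0 2] by auto
qed

text \<open>Passing from \<open>y\<close> to \<open>y'\<close> lowers \<open>g\<close> and with it
  \<open>\<rho>\<close>, raises \<open>v\<close>, and raises neither \<open>1 / a^2\<close> nor
  \<open>1 / A^2\<close>; by \<open>curve_constant_mono\<close> the constant \<open>c\<close> would
  drop, yet it is the same at both zeros.\<close>

lemma riley_plus_zero_less_False: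
  assumes x: "x\<^sup>2 \<le> 4" and y: "2 < y" "y < y'"
    and zero: "riley_plus M N x y = 0" "riley_plus M N x y' = 0"
  shows False
proof -
  define c where "c = 4 - x\<^sup>2"
  define v where "v y = (y - 2) * (y - 2 + c) * (chebS (Suc M) y)\<^sup>2" for y
  define g where "g y = (chebS (Suc M) y - chebS M y) / (chebS (Suc M) y * (y - 2))" for y :: real
  define \<rho> where "\<rho> y = 4 * g y * (1 + g y)" for y
  have g: "g y = 1 / cheb_quot M y" for y by (simp add: g_def cheb_quot_def mult.commute)
  have Z: "0 < v y" "g y = 1 / cheb_quot N (2 + v y)"
    "(y - 2) * (\<rho> y * (y - 2) - 4) / 4 = 1 / (chebS (Suc M) y)\<^sup>2"
    "v y * (\<rho> y * v y - 4) / 4 = 1 / (chebS (Suc N) (2 + v y))\<^sup>2"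
    "c = \<rho> y * (y - 2) * v y / 4 - (y - 2) - v y" "0 < g y"
    if "2 < y" "riley_plus M N x y = 0" for y
  proof -
    have a: "0 < chebS (Suc M) y" using chebS_step[of y M] that(1) by linarith
    show v0: "0 < v y" unfolding v_def using a that x by (simp add: c_def)
    have z: "2 + (y - 2) * (y + 2 - x\<^sup>2) * (chebS (Suc M) y)\<^sup>2 = 2 + v y"
      by (simp add: v_def c_def algebra_simps)
    have nM: "(chebS (Suc M) y)\<^sup>2 - (2 + (y - 2)) * chebS (Suc M) y * chebS M y + (chebS M y)\<^sup>2 = 1"
      using chebS_norm[of M y] by simp
    have zz: "chebS (Suc N) (2 + v y) - chebS N (2 + v y)
        = (y - 2 + c) * chebS (Suc M) y * (chebS (Suc M) y - chebS M y) * chebS (Suc N) (2 + v y)"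
      using that(2) unfolding riley_plus_def Let_def z by (simp add: c_def algebra_simps)
    note C = zero_curve[OF nM chebS_norm[of N "2 + v y", unfolded v_def] zz[unfolded v_def],
        folded v_def, folded g_def, folded \<rho>_def]
    have vn: "v y \<noteq> 0" using v0 by simp
    show "g y = 1 / cheb_quot N (2 + v y)"
      unfolding C(2)[OF vn] by (simp add: cheb_quot_def mult.commute)
    show "(y - 2) * (\<rho> y * (y - 2) - 4) / 4 = 1 / (chebS (Suc M) y)\<^sup>2"
      "v y * (\<rho> y * v y - 4) / 4 = 1 / (chebS (Suc N) (2 + v y))\<^sup>2"
      "c = \<rho> y * (y - 2) * v y / 4 - (y - 2) - v y"
      using C(4-6)[OF vn] by auto
    show "0 < g y" unfolding g using cheb_quot_pos[OF that(1)] by simp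
  qed
  have y': "2 < y'" using y by simp
  note Zy = Z[OF y(1) zero(1)] and Zy' = Z[OF y' zero(2)]
  have gg: "g y' < g y"
    unfolding g using cheb_quot_strict_mono[OF y, of M] cheb_quot_pos[OF y(1), of M]
    by (intro divide_strict_left_mono mult_pos_pos) auto
  \<comment> \<open>At a zero \<open>g\<close> is the reciprocal of \<open>cheb_quot\<close> both at
    \<open>y\<close> and at \<open>2 + v y\<close>, so a smaller \<open>g\<close> forces a larger
    \<open>v\<close>.\<close>
  have vv: "v y < v y'"
  proof (rule ccontr)
    assume "\<not> v y < v y'"
    then have "cheb_quot N (2 + v y') \<le> cheb_quot N (2 + v y)"
      using cheb_quot_strict_mono[of "2 + v y'" "2 + v y" N] Zy' by (cases "v y = v y'") auto
    then have "g y \<le> g y'"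
      unfolding Zy(2) Zy'(2) using cheb_quot_pos[of "2 + v y'" N] Zy'(1)
      by (intro divide_left_mono mult_pos_pos) auto
    then show False using gg by simp
  qed
  have inv: "1 / (chebS (Suc k) w')\<^sup>2 \<le> 1 / (chebS (Suc k) w)\<^sup>2" "0 < 1 / (chebS (Suc k) w')\<^sup>2"
    if "2 < w" "w < w'" for k and w w' :: real
  proof -
    have "0 < chebS (Suc k) w" using chebS_step[of w k] that by linarith
    moreover have "chebS (Suc k) w \<le> chebS (Suc k) w'" using that by (intro chebS_mono) auto
    ultimately show "1 / (chebS (Suc k) w')\<^sup>2 \<le> 1 / (chebS (Suc k) w)\<^sup>2"
      "0 < 1 / (chebS (Suc k) w')\<^sup>2"
      by (auto intro!: divide_left_mono power_mono)
  qed
  have "\<rho> y' * (y' - 2) * v y' / 4 - (y' - 2) - v y' < \<rho> y * (y - 2) * v y / 4 - (y - 2) - v y"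
  proof (rule curve_constant_mono)
    show "0 < \<rho> y'" using Zy'(6) by (simp add: \<rho>_def add_pos_pos)
    have "g y' * (1 + g y') < g y * (1 + g y)"
      using gg Zy'(6) by (intro mult_strict_mono) auto
    then show "\<rho> y' < \<rho> y" by (simp add: \<rho>_def)
    show "0 < (y' - 2) * (\<rho> y' * (y' - 2) - 4)"
      "(y' - 2) * (\<rho> y' * (y' - 2) - 4) \<le> (y - 2) * (\<rho> y * (y - 2) - 4)"
      using inv[OF y, of M] Zy(3) Zy'(3) by linarith+
    show "0 < v y' * (\<rho> y' * v y' - 4)"
      "v y' * (\<rho> y' * v y' - 4) \<le> v y * (\<rho> y * v y - 4)"
      using inv[of "2 + v y" "2 + v y'" N] Zy(1,4) Zy'(4) vv by linarith+
  qed (use y Zy(1) Zy'(1) in auto)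
  then show False using Zy(5) Zy'(5) by simp
qed

theorem theorem1:
  fixes m n :: nat and x\<^sub>0 :: real
  assumes "m > 0" and "n > 0"
    and "sqrt (4 - inverse (real m * real n)) < \<bar>x\<^sub>0\<bar>" and "\<bar>x\<^sub>0\<bar> \<le> 2"
  shows "(\<exists>!y::real. eval2 (riley_poly (4*m*n - 1) (4*m*n - 2*n - 1))
            (complex_of_real x\<^sub>0) (complex_of_real y) = 0)
       \<and> (\<nexists>y::real. eval2 (riley_poly (4*m*n + 1) (4*m*n - 2*n + 1))
            (complex_of_real x\<^sub>0) (complex_of_real y) = 0)"
proof -
  obtain M N where MN: "m = Suc M" "n = Suc N" using assms(1,2) gr0_implies_Suc by blast
  have x4: "x\<^sub>0\<^sup>2 \<le> 4" using assms(4) abs_le_square_iff[of x\<^sub>0 2] by simp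
  have "4 - inverse (real m * real n) < x\<^sub>0\<^sup>2"
    using assms(3) real_sqrt_less_iff[of "4 - inverse (real m * real n)" "x\<^sub>0\<^sup>2"] by simp
  then have "4 - x\<^sub>0\<^sup>2 < inverse (real m * real n)" by linarith
  then have "(4 - x\<^sub>0\<^sup>2) * (real m * real n) < inverse (real m * real n) * (real m * real n)"
    using assms(1,2) by (intro mult_strict_right_mono) auto
  also have "inverse (real m * real n) * (real m * real n) = 1"
    using assms(1,2) by (intro left_inverse) auto
  finally have c: "(4 - x\<^sub>0\<^sup>2) * (real (Suc M) * real (Suc N)) < 1" unfolding MN .
  have c0: "0 \<le> 4 - x\<^sub>0\<^sup>2" using x4 by simp
  note nonpos = riley_nonzero_nonpos[OF c0 c]
  have "\<exists>!y. riley_plus M N x\<^sub>0 y = 0"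
  proof (rule ex_ex1I)
    show "\<exists>y. riley_plus M N x\<^sub>0 y = 0" by (rule riley_plus_zero_ex[OF x4 c])
    fix y y' assume zero: "riley_plus M N x\<^sub>0 y = 0" "riley_plus M N x\<^sub>0 y' = 0"
    then have "2 < y" "2 < y'" using nonpos(1) by (meson not_le)+
    with zero show "y = y'"
      using riley_plus_zero_less_False[OF x4] by (metis linorder_neqE_linordered_idom)
  qed
  moreover have "riley_minus M N x\<^sub>0 y \<noteq> 0" for y
    using nonpos(2) riley_minus_pos[OF x4, of y M N] by (cases "y \<le> 2") auto
  ultimately show ?thesis
    unfolding MN eval2_riley_plus eval2_riley_minus of_real_eq_0_iff by blast
qed

end
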